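(* Let $n,m\in\mathbb{N}$. There exists a compact set $\Sigma_{\text{pk}}\subseteq\Sigma_{\text{stab}}$ that does not enable robust stabilization by linear dynamic state-feedback.
   Context: $\Sigma_{\text{stab}}$ is the set of stabilizable pairs $(A,B)\in\mathbb{R}^{n\times n}\times\mathbb{R}^{n\times m}$, i.e., those for which there exists $K\in\mathbb{R}^{m\times n}$ such that every eigenvalue $\lambda$ of $A+BK$ satisfies $|\lambda|<1$. For $p\in\mathbb{N}$ (positive integers), $K\in\mathbb{R}^{p\times p}$, $L\in\mathbb{R}^{p\times n}$, $M\in\mathbb{R}^{m\times p}$, $N\in\mathbb{R}^{m\times n}$, consider the closed-loop system $$x(t+1)=(A+BN)x(t)+BMz(t),\qquad z(t+1)=Lx(t)+Kz(t),\qquad t\in\mathbb{Z}_+=\{0,1,2,\dots\},$$ with $x(t)\in\mathbb{R}^n$, $z(t)\in\mathbb{R}^p$, and let $x(t,x_0,z_0)$, $z(t,x_0,z_0)$ denote its solution from $x(0)=x_0$, $z(0)=z_0$. This system is globally asymptotically stable with respect to $x$ if (1) for every $\varepsilon>0$ there exists $\delta>0$ such that $\|x_0\|\le\delta$ implies $\|x(t,x_0,z_0)\|\le\varepsilon$ for all $t\in\mathbb{Z}_+$ and all $z_0\in\mathbb{R}^p$; and (2) $\lim_{t\to\infty}x(t,x_0,z_0)=0$ for every $x_0\in\mathbb{R}^n$, $z_0\in\mathbb{R}^p$. A set $\Sigma_{\text{pk}}$ enables robust stabilization by linear dynamic state-feedback if there exist $p\in\mathbb{N}$, $K\in\mathbb{R}^{p\times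 p}$, $L\in\mathbb{R}^{p\times n}$, $M\in\mathbb{R}^{m\times p}$, $N\in\mathbb{R}^{m\times n}$ such that: (a) the closed-loop system is globally asymptotically stable with respect to $x$ for all $(A,B)\in\Sigma_{\text{pk}}$; and (b) for every $x_0\in\mathbb{R}^n$, $z_0\in\mathbb{R}^p$ and $(A,B)\in\Sigma_{\text{pk}}$, $\|z(t,x_0,z_0)\|$ is bounded over $t\in\mathbb{Z}_+$. *)

theory Defs
  imports "HOL-Analysis.Analysis"
begin

definition complex_eigenvalue :: "real^'n^'n \<Rightarrow> complex \<Rightarrow> bool" where
  "complex_eigenvalue A c \<longleftrightarrow>
     (\<exists>v :: complex^'n. v \<noteq> 0 \<and> map_matrix complex_of_real A *v v = c *s v)"

definition stabilizable_pairs :: "((real^'n^'n) \<times> (real^'m^'n)) set" where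
  "stabilizable_pairs =
     {(A, B). \<exists>K :: real^'n^'m. \<forall>c. complex_eigenvalue (A + B ** K) c \<longrightarrow> cmod c < 1}"

text \<open>
  The controller dimension \<open>p\<close> is quantified existentially inside the statement, so it cannot be
  a type. Vectors of length \<open>p\<close> are functions on \<open>nat\<close> of which only the entries with index below
  \<open>p\<close> are ever used, and likewise for the matrices having a dimension \<open>p\<close>:
  \<open>K i j\<close> is the entry in row \<open>i\<close> and column \<open>j\<close> of the \<open>p \<times> p\<close> matrix,
  \<open>L i\<close> is row \<open>i\<close> of the \<open>p \<times> n\<close> matrix, and
  \<open>M j\<close> is column \<open>j\<close> of the \<open>m \<times> p\<close> matrix.
\<close>

primrec closed_loop ::
  "real^'n^'n \<Rightarrow> real^'m^'n \<Rightarrow>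
   nat \<Rightarrow> (nat \<Rightarrow> nat \<Rightarrow> real) \<Rightarrow> (nat \<Rightarrow> real^'n) \<Rightarrow> (nat \<Rightarrow> real^'m) \<Rightarrow> real^'n^'m \<Rightarrow>
   real^'n \<Rightarrow> (nat \<Rightarrow> real) \<Rightarrow> nat \<Rightarrow> (real^'n) \<times> (nat \<Rightarrow> real)" where
  "closed_loop A B p K L M N x0 z0 0 = (x0, z0)"
| "closed_loop A B p K L M N x0 z0 (Suc t) =
     (let (x, z) = closed_loop A B p K L M N x0 z0 t in
       ((A + B ** N) *v x + B *v (\<Sum>j<p. z j *\<^sub>R M j),
        (\<lambda>i. L i \<bullet> x + (\<Sum>j<p. K i j * z j))))"

definition plant_state ::
  "real^'n^'n \<Rightarrow> real^'m^'n \<Rightarrow>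
   nat \<Rightarrow> (nat \<Rightarrow> nat \<Rightarrow> real) \<Rightarrow> (nat \<Rightarrow> real^'n) \<Rightarrow> (nat \<Rightarrow> real^'m) \<Rightarrow> real^'n^'m \<Rightarrow>
   real^'n \<Rightarrow> (nat \<Rightarrow> real) \<Rightarrow> nat \<Rightarrow> real^'n" where
  "plant_state A B p K L M N x0 z0 t = fst (closed_loop A B p K L M N x0 z0 t)"

definition controller_state ::
  "real^'n^'n \<Rightarrow> real^'m^'n \<Rightarrow>
   nat \<Rightarrow> (nat \<Rightarrow> nat \<Rightarrow> real) \<Rightarrow> (nat \<Rightarrow> real^'n) \<Rightarrow> (nat \<Rightarrow> real^'m) \<Rightarrow> real^'n^'m \<Rightarrow>
   real^'n \<Rightarrow> (nat \<Rightarrow> real) \<Rightarrow> nat \<Rightarrow> (nat \<Rightarrow> real)" where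
  "controller_state A B p K L M N x0 z0 t = snd (closed_loop A B p K L M N x0 z0 t)"

definition gas_wrt_x ::
  "real^'n^'n \<Rightarrow> real^'m^'n \<Rightarrow>
   nat \<Rightarrow> (nat \<Rightarrow> nat \<Rightarrow> real) \<Rightarrow> (nat \<Rightarrow> real^'n) \<Rightarrow> (nat \<Rightarrow> real^'m) \<Rightarrow> real^'n^'m \<Rightarrow> bool" where
  "gas_wrt_x A B p K L M N \<longleftrightarrow>
     (\<forall>\<epsilon>>0. \<exists>\<delta>>0. \<forall>x0. norm x0 \<le> \<delta> \<longrightarrow>
        (\<forall>t z0. norm (plant_state A B p K L M N x0 z0 t) \<le> \<epsilon>)) \<and>
     (\<forall>x0 z0. (\<lambda>t. plant_state A B p K L M N x0 z0 t) \<longlonglongrightarrow> 0)"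

text \<open>\<open>L2_set z {..<p}\<close> is the Euclidean norm of the vector \<open>z\<close> of length \<open>p\<close>.\<close>

definition enables_robust_stabilization :: "((real^'n^'n) \<times> (real^'m^'n)) set \<Rightarrow> bool" where
  "enables_robust_stabilization \<Sigma> \<longleftrightarrow>
     (\<exists>p>0. \<exists>(K :: nat \<Rightarrow> nat \<Rightarrow> real) (L :: nat \<Rightarrow> real^'n) (M :: nat \<Rightarrow> real^'m) (N :: real^'n^'m).
        (\<forall>(A, B) \<in> \<Sigma>. gas_wrt_x A B p K L M N) \<and>
        (\<forall>x0 z0. \<forall>(A, B) \<in> \<Sigma>.
           \<exists>C. \<forall>t. L2_set (controller_state A B p K L M N x0 z0 t) {..<p} \<le> C))"

end

theory Submission
  imports Defs
begin

text \<open>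
  The stability bound is uniform in \<open>z\<^sub>0\<close>, while \<open>x(1) = B M z\<^sub>0\<close> for \<open>x\<^sub>0 = 0\<close> is linear in \<open>z\<^sub>0\<close>;
  hence \<open>B M = 0\<close> and the controller acts as the static feedback \<open>N\<close>. With \<open>A = 2 e\<^sub>k e\<^sub>k\<^sup>T\<close> and
  \<open>B = \<plusminus> e\<^sub>k e\<^sub>l\<^sup>T\<close>, the vector \<open>e\<^sub>k\<close> is an eigenvector of \<open>A + B N\<close> with eigenvalue \<open>2 \<plusminus> N\<^sub>l\<^sub>k\<close>,
  and these two numbers cannot both lie in \<open>(-1, 1)\<close>.
\<close>

lemma gas_wrt_x_imp_controller_decoupled:
  assumes "gas_wrt_x A B p K L M N"
  shows "B *v (\<Sum>j<p. z j *\<^sub>R M j) = 0"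
proof (rule ccontr)
  define b where "b = B *v (\<Sum>j<p. z j *\<^sub>R M j)"
  assume "B *v (\<Sum>j<p. z j *\<^sub>R M j) \<noteq> 0"
  then have b: "norm b > 0"
    by (simp add: b_def)
  obtain \<delta> where "\<delta> > 0" and
    \<delta>: "\<And>x0 t z0. norm x0 \<le> \<delta> \<Longrightarrow> norm (plant_state A B p K L M N x0 z0 t) \<le> 1"
    using assms unfolding gas_wrt_x_def by (meson zero_less_one)
  \<comment> \<open>Scaling the controller state by \<open>r\<close> makes the plant state at time 1
    have norm 2, above the bound 1 taken for \<epsilon>; the plant starts at 0, which meets every
    \<delta>.\<close>
  define r where "r = 2 / norm b"
  have "plant_state A B p K L M N 0 (\<lambda>j. r * z j) (Suc 0) = r *\<^sub>R b"
    unfolding plant_state_def b_def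
    by (simp add: scaleR_sum_right[symmetric] matrix_vector_mult_scaleR flip: scaleR_scaleR)
  moreover have "norm (r *\<^sub>R b) = 2"
    using b by (simp add: r_def)
  ultimately show False
    using \<delta>[of 0 "\<lambda>j. r * z j" "Suc 0"] \<open>\<delta> > 0\<close> by simp
qed

text \<open>Since the controller term vanishes, the trajectory from \<open>v\<close> is
  \<open>c ^ t *\<^sub>R v\<close> for every \<open>z0\<close>.\<close>

lemma gas_wrt_x_imp_eigenvalue_less_1:
  assumes gas: "gas_wrt_x A B p K L M N"
    and eig: "(A + B ** N) *v v = c *\<^sub>R v" and "v \<noteq> 0"
  shows "\<bar>c\<bar> < 1"
proof (rule ccontr)
  assume "\<not> \<bar>c\<bar> < 1"
  have state: "plant_state A B p K L M N v z0 t = c ^ t *\<^sub>R v" for z0 t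
  proof (induction t)
    case (Suc t)
    then show ?case
      by (simp add: plant_state_def Let_def case_prod_beta gas_wrt_x_imp_controller_decoupled[OF gas]
          matrix_vector_mult_scaleR eig mult.commute)
  qed (simp add: plant_state_def)
  have "(\<lambda>t. c ^ t *\<^sub>R v) \<longlonglongrightarrow> 0"
    using gas unfolding gas_wrt_x_def by (simp flip: state[where ?z0.0 = "\<lambda>_. 0"])
  then have "(\<lambda>t. norm (c ^ t *\<^sub>R v)) \<longlonglongrightarrow> 0"
    by (rule tendsto_norm_zero)
  \<comment> \<open>With \<bar>c\<bar> at least 1 the norms never fall below \<open>norm v\<close>,
    so the limit 0 would force \<open>v = 0\<close>.\<close>
  moreover have "norm v \<le> norm (c ^ t *\<^sub>R v)" for t
    using \<open>\<not> \<bar>c\<bar> < 1\<close> mult_right_mono[of 1 "\<bar>c\<bar> ^ t" "norm v"]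
    by (simp add: power_abs one_le_power)
  ultimately have "norm v \<le> 0"
    by (intro LIMSEQ_le_const) auto
  then show False
    using \<open>v \<noteq> 0\<close> by simp
qed

text \<open>The rank-one matrix written \<open>e_k e_l^T\<close> in the overview.\<close>

definition unit_matrix :: "'n \<Rightarrow> 'm \<Rightarrow> real^'m^'n" where
  "unit_matrix k l = (\<chi> i j. if i = k \<and> j = l then 1 else 0)"

lemma unit_matrix_mult_vec: "unit_matrix k l *v x = x $ l *\<^sub>R axis k 1"
  by (auto simp: vec_eq_iff unit_matrix_def matrix_vector_mult_def axis_def
      if_distrib[of "\<lambda>a. a * _"] cong: if_cong)

lemma unit_matrix_mult: "unit_matrix k l ** unit_matrix l j = unit_matrix k j"
  by (auto simp: vec_eq_iff unit_matrix_def matrix_matrix_mult_def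
      if_distrib[of "\<lambda>a. a * _"] cong: if_cong)

lemma complex_eigenvalue_zero_matrix: "complex_eigenvalue 0 c \<Longrightarrow> c = 0"
  by (auto simp: complex_eigenvalue_def map_matrix_def vec_eq_iff matrix_vector_mult_def)

text \<open>The feedback \<open>- 2 * s\<close> times \<open>unit_matrix l k\<close> cancels A
  exactly because \<open>s * s = 1\<close>; the closed loop is the zero matrix, with 0 as its only
  eigenvalue.\<close>

lemma unit_matrix_pair_stabilizable:
  assumes "s * s = 1"
  shows "(2 *\<^sub>R unit_matrix k k, s *\<^sub>R unit_matrix k l) \<in> stabilizable_pairs"
proof -
  have "(s *\<^sub>R unit_matrix k l) ** ((- 2 * s) *\<^sub>R unit_matrix l k) =
      (- 2 * (s * s)) *\<^sub>R unit_matrix k k"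
    by (simp only: matrix_scalar_ac scalar_matrix_assoc[symmetric] scaleR_scaleR unit_matrix_mult)
      (simp add: mult_ac)
  then have "2 *\<^sub>R unit_matrix k k + (s *\<^sub>R unit_matrix k l) ** ((- 2 * s) *\<^sub>R unit_matrix l k) = 0"
    using assms by simp
  then show ?thesis
    unfolding stabilizable_pairs_def
    by (auto intro!: exI[of _ "(- 2 * s) *\<^sub>R unit_matrix l k"] simp del: mult_minus_left
        dest!: complex_eigenvalue_zero_matrix)
qed

lemma unit_matrix_pair_closed_loop:
  "(2 *\<^sub>R unit_matrix k k + s *\<^sub>R unit_matrix k l ** N) *v axis k 1 =
    (2 + s * N $ l $ k) *\<^sub>R axis k 1"
  by (simp add: matrix_vector_mult_add_rdistrib scaleR_matrix_vector_assoc[symmetric]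
      matrix_vector_mul_assoc[symmetric] unit_matrix_mult_vec scaleR_left_distrib
      matrix_vector_mul_component cart_eq_inner_axis[symmetric])

theorem theorem18:
  shows "\<exists>\<Sigma>\<^sub>p\<^sub>k :: ((real^'n^'n) \<times> (real^'m^'n)) set.
    compact \<Sigma>\<^sub>p\<^sub>k \<and> \<Sigma>\<^sub>p\<^sub>k \<subseteq> stabilizable_pairs \<and>
    \<not> enables_robust_stabilization \<Sigma>\<^sub>p\<^sub>k"
proof -
  fix k :: 'n and l :: 'm
  define S where "S = (\<lambda>s. (2 *\<^sub>R unit_matrix k k, s *\<^sub>R unit_matrix k l)) ` {1, -1 :: real}"
  have "\<not> enables_robust_stabilization S"
  proof
    assume "enables_robust_stabilization S"
    then obtain p K L M and N :: "real^'n^'m"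
      where gas: "\<forall>(A, B) \<in> S. gas_wrt_x A B p K L M N"
      unfolding enables_robust_stabilization_def by blast
    \<comment> \<open>The same \<open>N\<close> must serve both signs of \<open>s\<close>.\<close>
    have "\<bar>2 + s * N $ l $ k\<bar> < 1" if "s \<in> {1, -1}" for s
    proof (rule gas_wrt_x_imp_eigenvalue_less_1[OF _ unit_matrix_pair_closed_loop])
      show "gas_wrt_x (2 *\<^sub>R unit_matrix k k) (s *\<^sub>R unit_matrix k l) p K L M N"
        using gas that unfolding S_def by blast
      show "axis k 1 \<noteq> (0 :: real^'n)"
        by (simp add: axis_eq_0_iff)
    qed
    \<comment> \<open>The two numbers add up to 4, but each is below 1.\<close>
    from this[of 1] this[of "-1"] show False
      by simp
  qed
  moreover have "S \<subseteq> stabilizable_pairs"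
    using unit_matrix_pair_stabilizable[of 1] unit_matrix_pair_stabilizable[of "-1"]
    unfolding S_def by auto
  moreover have "compact S"
    unfolding S_def by (intro finite_imp_compact) simp
  ultimately show ?thesis
    by blast
qed

end
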